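(* Let $A,B,C,D\in\mathbb{R}^{n\times n}$ be such that $B\geq 0$, $C\leq 0$ and $I\otimes D+(A^T\otimes I)\Pi$ is a nonsingular M-matrix, let $\mathcal{R}_T(X)=DX+X^TA-X^TBX+C$ for $X\in\mathbb{R}^{n\times n}$, and let $X_{\min}$ be the minimal nonnegative solution of $\mathcal{R}_T(X)=0$. Assume there exists a matrix $\overline{Y}$ such that $\mathcal{R}_T(\overline{Y})>0$. Then the sequence $\{X_k\}_{k\geq 0}$ computed by the Newton method $$(D-X_k^TB)X_{k+1}+X_{k+1}^T(A-BX_k)=-X_k^TBX_k-C,\qquad k\geq 0,$$ with $X_0=0$ is well-defined and $X_k\leq X_{k+1}\leq X_{\min}$ for any $k\geq 0$. Moreover, $\{X_k\}_{k\geq 0}$ converges to the minimal nonnegative solution $X_{\min}$ of $\mathcal{R}_T(X)=0$.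
   Context: All matrix inequalities are entrywise: $M\geq 0$ ($M>0$) means all entries of $M$ are nonnegative (positive); $M\leq 0$ means $-M\geq 0$; $M\geq N$ means $M-N\geq 0$. A Z-matrix is a square real matrix whose off-diagonal entries are all nonpositive; it can be written as $sI-N$ with $s\in\mathbb{R}$, $N\geq 0$, and it is called an M-matrix if $s\geq\rho(N)$, where $\rho$ denotes the spectral radius. $\otimes$ is the Kronecker product, $I=I_n$ is the identity matrix, and $\Pi\in\mathbb{R}^{n^2\times n^2}$ is the permutation matrix $\Pi=\sum_{i=1}^n\sum_{j=1}^n E_{i,j}\otimes E_{j,i}$, where $E_{i,j}\in\mathbb{R}^{n\times n}$ has $(i,j)$ entry $1$ and all other entries zero. The minimal nonnegative solution of $\mathcal{R}_T(X)=0$ is the nonnegative solution $X_{\min}$ satisfying $X_{\min}\leq X$ for every nonnegative solution $X$. The sequence being well-defined means that each of the linear equations defining $X_{k+1}$ from $X_k$ is uniquely solvable.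
   Formalization: The matrix Ȳ with R_T(Ȳ)>0 is additionally required to satisfy Ȳ≥0; without this the claim fails, e.g. n=2, D=I, A=0, B=E_12, C=−E_12, Ȳ with rows (1,2), (−1,−1), where the equation for X_2 is singular. *)

theory Defs
  imports "HOL-Analysis.Analysis"
begin

(* M >= 0, M <= 0 and M <= N are written with the library order on vectors, which is the entrywise
   order. The library's strict order x < y on vectors only means x <= y and x ~= y, hence the
   separate definition of M > 0. *)
definition pos_matrix :: "real ^ 'n ^ 'm \<Rightarrow> bool" where
  "pos_matrix M \<longleftrightarrow> (\<forall>i j. M $ i $ j > 0)"

definition spectrum :: "real ^ 'n ^ 'n \<Rightarrow> complex set" where
  "spectrum M = {c. \<exists>v. v \<noteq> 0 \<and> map_matrix complex_of_real M *v v = c *s v}"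

definition spectral_radius :: "real ^ 'n ^ 'n \<Rightarrow> real" where
  "spectral_radius M = Max (cmod ` spectrum M)"

definition Z_matrix :: "real ^ 'n ^ 'n \<Rightarrow> bool" where
  "Z_matrix M \<longleftrightarrow> (\<forall>i j. i \<noteq> j \<longrightarrow> M $ i $ j \<le> 0)"

definition M_matrix :: "real ^ 'n ^ 'n \<Rightarrow> bool" where
  "M_matrix M \<longleftrightarrow> Z_matrix M \<and>
     (\<exists>s N. M = s *\<^sub>R mat 1 - N \<and> N \<ge> 0 \<and> s \<ge> spectral_radius N)"

(* The n^2 x n^2 matrices are indexed by pairs: (i, k) stands for the position (i - 1) n + k,
   i.e. entry k of block i. *)
definition kronecker ::
  "real ^ 'n::finite ^ 'm::finite \<Rightarrow> real ^ 'q::finite ^ 'p::finite \<Rightarrow> real ^ ('n \<times> 'q) ^ ('m \<times> 'p)" where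
  "kronecker M N = (\<chi> r c. M $ fst r $ fst c * N $ snd r $ snd c)"

definition unit_matrix :: "'n \<Rightarrow> 'n \<Rightarrow> real ^ 'n ^ 'n" where
  "unit_matrix i j = (\<chi> k l. if k = i \<and> l = j then 1 else 0)"

definition Pi_matrix :: "real ^ ('n::finite \<times> 'n) ^ ('n \<times> 'n)" where
  "Pi_matrix = (\<Sum>i\<in>UNIV. \<Sum>j\<in>UNIV. kronecker (unit_matrix i j) (unit_matrix j i))"

definition riccati ::
  "real ^ 'n ^ 'n \<Rightarrow> real ^ 'n ^ 'n \<Rightarrow> real ^ 'n ^ 'n \<Rightarrow> real ^ 'n ^ 'n \<Rightarrow>
   real ^ 'n ^ 'n \<Rightarrow> real ^ 'n ^ 'n" where
  "riccati A B C D X = D ** X + transpose X ** A - transpose X ** B ** X + C"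

definition minimal_nonneg_solution ::
  "real ^ 'n ^ 'n \<Rightarrow> real ^ 'n ^ 'n \<Rightarrow> real ^ 'n ^ 'n \<Rightarrow> real ^ 'n ^ 'n \<Rightarrow>
   real ^ 'n ^ 'n \<Rightarrow> bool" where
  "minimal_nonneg_solution A B C D Xmin \<longleftrightarrow>
     riccati A B C D Xmin = 0 \<and> Xmin \<ge> 0 \<and>
     (\<forall>X. riccati A B C D X = 0 \<and> X \<ge> 0 \<longrightarrow> Xmin \<le> X)"

(* The linear equation of one Newton step: X is the current iterate, Z the next one. *)
definition newton_eq ::
  "real ^ 'n ^ 'n \<Rightarrow> real ^ 'n ^ 'n \<Rightarrow> real ^ 'n ^ 'n \<Rightarrow> real ^ 'n ^ 'n \<Rightarrow>
   real ^ 'n ^ 'n \<Rightarrow> real ^ 'n ^ 'n \<Rightarrow> bool" where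
  "newton_eq A B C D X Z \<longleftrightarrow>
     (D - transpose X ** B) ** Z + transpose Z ** (A - B ** X) = - (transpose X ** B ** X) - C"

(* A point Y with R_T(Y) > 0 has to be required to be nonnegative for it to control the Newton
   iteration. For n = 2, D = I, A = 0, B = E_12, C = - E_12 the minimal nonnegative solution is
   E_12 and R_T(Y) > 0 for Y with rows (1, 2) and (-1, -1), but the iteration breaks down:
   X_1 = E_12 and the equation for X_2 is singular. *)

end

theory Submission
  imports Defs
begin

text \<open>
  Write \<open>R\<close> for the Riccati map and \<open>L\<^sub>X(Z) = (D - X\<^sup>T B) Z + Z\<^sup>T (A - B X)\<close> for the linear
  operator of a Newton step at \<open>X\<close>. Since \<open>R\<close> is quadratic, its expansion around \<open>X\<close> is exact:
  \<open>L\<^sub>X(W - Z) = [R(W) + (W - X)\<^sup>T B (W - X)] - [R(Z) + (Z - X)\<^sup>T B (Z - X)]\<close>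
  (\<open>newton_op_diff\<close>), and \<open>Z\<close> is the Newton iterate after \<open>X\<close> exactly when the second bracket
  vanishes. If the matrix of \<open>L\<^sub>X\<close> is a nonsingular M-matrix, then \<open>L\<^sub>X\<close> is inverse nonnegative, so
  every order relation of the iteration is read off from a sign of the right-hand side: \<open>W = Xmin\<close>
  gives \<open>Z \<le> Xmin\<close>, \<open>W = X\<close> with \<open>R(X) \<le> 0\<close> gives \<open>X \<le> Z\<close>, and \<open>W = Y\<close> gives \<open>Z \<le> Y\<close>. Moreover
  \<open>R(Z) = - (Z - X)\<^sup>T B (Z - X) \<le> 0\<close>, which restores the sign condition at the next iterate.

  What has to be propagated is the M-matrix property. It is used in the form ``Z-matrix that maps
  some positive vector to a positive vector''; the witness for \<open>L\<^sub>Z\<close> is \<open>Y - Z\<close>, because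
  \<open>L\<^sub>Z(Y - Z) = R(Y) + (Y - Z)\<^sup>T B (Y - Z) - R(Z) \<ge> R(Y) > 0\<close>. This is the only place where
  strict positivity of \<open>R(Y)\<close> enters (\<open>semipositive_newton\<close>).

  The hypothesis at \<open>X = 0\<close> is given through the spectral radius and is brought into this form in
  \<open>invertible_M_matrix_semipositive\<close>, by a continuity argument in the shift \<open>t\<close> of \<open>t I - N\<close>
  that takes the place of Perron--Frobenius theory. Finally, the iterates increase and are bounded,
  their limit solves the Riccati equation and lies below \<open>Xmin\<close>, hence is \<open>Xmin\<close> by minimality.
\<close>

section \<open>Z-matrices that map some positive vector to a positive vector\<close>

definition semipositive :: "real ^ 'm ^ 'm \<Rightarrow> bool" where
  "semipositive M \<longleftrightarrow> (\<exists>v. (\<forall>i. v $ i > 0) \<and> (\<forall>i. (M *v v) $ i > 0))"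

text \<open>Let \<open>r\<close> be the largest number with \<open>r v \<le> z\<close>. At an index where \<open>z - r v\<close> vanishes, only the
  nonpositive off-diagonal entries act on it, so \<open>M (z - r v)\<close> is nonpositive there; \<open>r < 0\<close> would
  make it positive.\<close>
lemma Z_matrix_semipositive_monotone:
  fixes M :: "real ^ 'm ^ 'm"
  assumes Z: "Z_matrix M" and "semipositive M" and Mz: "M *v z \<ge> 0"
  shows "z \<ge> 0"
proof -
  obtain v where v: "\<And>i. v $ i > 0" and Mv: "\<And>i. (M *v v) $ i > 0"
    using \<open>semipositive M\<close> unfolding semipositive_def by blast
  obtain i where i: "\<And>j. z $ i / v $ i \<le> z $ j / v $ j"
  proof -
    have "Min (range (\<lambda>j. z $ j / v $ j)) \<in> range (\<lambda>j. z $ j / v $ j)"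
      by (rule Min_in) auto
    then obtain i where "Min (range (\<lambda>j. z $ j / v $ j)) = z $ i / v $ i" by blast
    moreover have "Min (range (\<lambda>j. z $ j / v $ j)) \<le> z $ j / v $ j" for j
      by (rule Min_le) auto
    ultimately have "\<And>j. z $ i / v $ i \<le> z $ j / v $ j" by simp
    then show ?thesis by (rule that)
  qed
  define r where "r = z $ i / v $ i"
  have r: "z $ j - r * v $ j \<ge> 0" for j
    using i[of j] v[of j] by (simp add: r_def pos_le_divide_eq)
  have r_i: "z $ i - r * v $ i = 0"
    using v[of i] by (simp add: r_def)
  have "r \<ge> 0"
  proof (rule ccontr)
    assume "\<not> r \<ge> 0"
    then have "r * (M *v v) $ i < 0"
      using Mv[of i] by (simp add: mult_neg_pos)
    moreover have "(M *v z) $ i \<ge> 0"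
      using Mz by (simp add: less_eq_vec_def)
    moreover have "(M *v z) $ i - r * (M *v v) $ i = (\<Sum>j\<in>UNIV. M $ i $ j * (z $ j - r * v $ j))"
      by (simp add: matrix_vector_mult_def sum_distrib_left sum_subtractf algebra_simps)
    moreover have "(\<Sum>j\<in>UNIV. M $ i $ j * (z $ j - r * v $ j)) \<le> 0"
    proof (rule sum_nonpos)
      fix j
      show "M $ i $ j * (z $ j - r * v $ j) \<le> 0"
        using Z r[of j] r_i unfolding Z_matrix_def
        by (cases "j = i") (auto intro: mult_nonpos_nonneg)
    qed
    ultimately show False by linarith
  qed
  have "z $ j \<ge> 0" for j
    using r[of j] mult_nonneg_nonneg[OF \<open>r \<ge> 0\<close> less_imp_le[OF v[of j]]] by linarith
  then show ?thesis by (simp add: less_eq_vec_def)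
qed

lemma Z_matrix_semipositive_invertible:
  fixes M :: "real ^ 'm ^ 'm"
  assumes "Z_matrix M" and "semipositive M"
  shows "invertible M"
proof -
  have "x = 0" if "M *v x = 0" for x
  proof -
    have "M *v x \<ge> 0" "M *v (- x) \<ge> 0"
      using that by (simp_all add: vec.neg)
    then have "x \<ge> 0" "- x \<ge> 0"
      using Z_matrix_semipositive_monotone[OF assms] by blast+
    then show "x = 0"
      by (simp add: less_eq_vec_def vec_eq_iff) (meson order_antisym)
  qed
  then show ?thesis
    by (simp add: invertible_left_inverse matrix_left_invertible_ker)
qed

text \<open>At an index where a nonnegative \<open>v\<close> vanishes, a Z-matrix can only produce a nonpositive value.
  This upgrades nonnegative witnesses of semipositivity to positive ones.\<close>
lemma Z_matrix_positive_preimage: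
  fixes M :: "real ^ 'm ^ 'm"
  assumes Z: "Z_matrix M" and v: "v \<ge> 0" and Mv: "(M *v v) $ i > 0"
  shows "v $ i > 0"
proof (rule ccontr)
  assume "\<not> v $ i > 0"
  then have v_i: "v $ i = 0"
    using v by (simp add: less_eq_vec_def) (meson order_antisym not_less)
  have "(M *v v) $ i = (\<Sum>j\<in>UNIV. M $ i $ j * v $ j)"
    by (simp add: matrix_vector_mult_def)
  also have "\<dots> \<le> 0"
  proof (rule sum_nonpos)
    fix j
    have "v $ j \<ge> 0" using v by (simp add: less_eq_vec_def)
    then show "M $ i $ j * v $ j \<le> 0"
      using Z v_i unfolding Z_matrix_def
      by (cases "j = i") (auto intro: mult_nonpos_nonneg)
  qed
  finally show False using Mv by simp
qed

section \<open>Nonsingular M-matrices are semipositive\<close>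

text \<open>Subtracting \<open>d\<close> times the relation from its image under \<open>N\<close> removes the eigenvector of \<open>d\<close>.\<close>
lemma eigenvectors_independent:
  fixes N :: "complex ^ 'm ^ 'm"
  assumes "finite S" and "\<And>c. c \<in> S \<Longrightarrow> v c \<noteq> 0 \<and> N *v v c = c *s v c"
    and "(\<Sum>c\<in>S. u c *s v c) = 0" and "c \<in> S"
  shows "u c = 0"
  using assms
proof (induction S arbitrary: u c rule: finite_induct)
  case empty
  then show ?case by simp
next
  case (insert d S)
  have sum0: "u d *s v d + (\<Sum>c\<in>S. u c *s v c) = 0"
    using insert by simp
  have "0 = N *v (u d *s v d + (\<Sum>c\<in>S. u c *s v c)) - d *s (u d *s v d + (\<Sum>c\<in>S. u c *s v c))"
    by (simp add: sum0)
  also have "\<dots> = (\<Sum>c\<in>S. (u c * (c - d)) *s v c)"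
  proof -
    have "N *v (\<Sum>c\<in>S. u c *s v c) = (\<Sum>c\<in>S. u c *s (c *s v c))"
      using insert.prems(1) by (simp add: vec.sum vec.scale)
    moreover have "N *v (u d *s v d) = u d *s (d *s v d)"
      using insert.prems(1) by (simp add: vec.scale)
    ultimately show ?thesis
      by (simp add: vec.add vec.scale_right_distrib vec.scale_sum_right sum_subtractf[symmetric]
          vec.scale_left_diff_distrib algebra_simps)
  qed
  finally have *: "(\<Sum>c\<in>S. (u c * (c - d)) *s v c) = 0" by simp
  have S0: "u c = 0" if "c \<in> S" for c
  proof -
    have "u c * (c - d) = 0"
      using insert.IH[OF _ * that] insert.prems(1) by simp
    then show ?thesis using that insert.hyps(2) by auto
  qed
  then have "u d *s v d = 0"
    using sum0 by simp
  then have "u d = 0"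
    using insert.prems(1) by (simp add: vec.scale_eq_0_iff)
  then show ?case using S0 insert.prems(3) by blast
qed

text \<open>The spectral radius is a maximum over the spectrum, so it bounds the eigenvalues only once the
  spectrum is known to be finite.\<close>
lemma finite_spectrum:
  fixes N :: "real ^ 'm ^ 'm"
  shows "finite (spectrum N)"
proof -
  define N' where "N' = map_matrix complex_of_real N"
  have "\<forall>c\<in>spectrum N. \<exists>v. v \<noteq> 0 \<and> N' *v v = c *s v"
    unfolding spectrum_def N'_def by simp
  then obtain v where v: "\<And>c. c \<in> spectrum N \<Longrightarrow> v c \<noteq> 0 \<and> N' *v v c = c *s v c"
    by metis
  have inj: "inj_on v (spectrum N)"
  proof (rule inj_onI)
    fix c d assume cd: "c \<in> spectrum N" "d \<in> spectrum N" "v c = v d"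
    then have "c *s v c = d *s v c" using v by metis
    then show "c = d" using v[OF cd(1)] by (metis vec.scale_right_imp_eq)
  qed
  have "vec.independent (v ` spectrum N)"
    unfolding vec.dependent_explicit
  proof clarify
    fix T u w assume T: "finite T" "T \<subseteq> v ` spectrum N" "(\<Sum>w\<in>T. u w *s w) = 0" "w \<in> T" "u w \<noteq> 0"
    then obtain S where S: "S \<subseteq> spectrum N" "T = v ` S"
      by (meson subset_imageE)
    have injS: "inj_on v S" using inj S(1) inj_on_subset by blast
    have "finite S" using S T(1) injS finite_imageD by blast
    moreover have "(\<Sum>c\<in>S. u (v c) *s v c) = 0"
      using T(3) S(2) injS by (simp add: sum.reindex)
    ultimately have "u (v c) = 0" if "c \<in> S" for c
      using eigenvectors_independent[of S v N' "\<lambda>c. u (v c)"] v S(1) that by blast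
    then show False using T S by blast
  qed
  then have "finite (v ` spectrum N)" by (rule vec.finiteI_independent)
  then show ?thesis using inj finite_imageD by blast
qed

lemma real_eigenvalue_le_spectral_radius:
  fixes N :: "real ^ 'm ^ 'm"
  assumes "x \<noteq> 0" and "N *v x = c *\<^sub>R x"
  shows "c \<le> spectral_radius N"
proof -
  let ?x = "\<chi> i. complex_of_real (x $ i)"
  have "map_matrix complex_of_real N *v ?x = complex_of_real c *s ?x"
    using assms(2) by (simp add: matrix_vector_mult_def vec_eq_iff flip: of_real_mult of_real_sum)
  moreover have "?x \<noteq> 0"
    using assms(1) by (simp add: vec_eq_iff)
  ultimately have "complex_of_real c \<in> spectrum N"
    unfolding spectrum_def by blast
  then have "cmod (complex_of_real c) \<le> spectral_radius N"
    unfolding spectral_radius_def by (intro Max_ge finite_imageI finite_spectrum imageI)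
  then show ?thesis by (simp add: norm_of_real)
qed

lemma shifted_matrix_vector_mult:
  fixes N :: "real ^ 'm ^ 'm"
  shows "(t *\<^sub>R mat 1 - N) *v x = t *\<^sub>R x - N *v x"
  by (simp add: matrix_vector_mult_diff_rdistrib flip: scaleR_matrix_vector_assoc)

text \<open>Every shift \<open>t I - N\<close> with \<open>t \<ge> s\<close> is invertible: no \<open>t > s\<close> is an eigenvalue, and \<open>t = s\<close> is the
  hypothesis. The set \<open>T\<close> of those shifts that are semipositive contains all large \<open>t\<close>, by diagonal
  dominance. Let \<open>\<tau>\<close> be its infimum and \<open>(\<tau> I - N) v = 1\<close>. Shifts close to \<open>\<tau>\<close> still map \<open>v\<close> to a
  positive vector, and one of them lies in \<open>T\<close> and is thus inverse nonnegative; hence \<open>v\<close> is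
  nonnegative, even positive, and witnesses that all admissible shifts near \<open>\<tau>\<close> lie in \<open>T\<close>. So the
  infimum is \<open>s\<close> itself, and it is attained.\<close>
lemma invertible_M_matrix_semipositive:
  fixes M :: "real ^ 'm ^ 'm"
  assumes "M_matrix M" and "invertible M"
  shows "semipositive M"
proof -
  obtain s N where M: "M = s *\<^sub>R mat 1 - N" and N: "N \<ge> 0" and s: "s \<ge> spectral_radius N"
    using assms(1) unfolding M_matrix_def by blast
  define K where "K t = t *\<^sub>R mat 1 - N" for t
  have N_nonneg: "N $ i $ j \<ge> 0" for i j
    using N by (simp add: less_eq_vec_def)
  have K_Z: "Z_matrix (K t)" for t
    using N_nonneg by (simp add: K_def Z_matrix_def mat_def)
  have K_mult: "K t *v x = t *\<^sub>R x - N *v x" for t x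
    by (simp add: K_def shifted_matrix_vector_mult)
  have K_inv: "invertible (K t)" if "t \<ge> s" for t
  proof (cases "t = s")
    case True
    then show ?thesis using assms(2) M by (simp add: K_def)
  next
    case False
    have "x = 0" if "K t *v x = 0" for x
    proof (rule ccontr)
      assume "x \<noteq> 0"
      moreover have "N *v x = t *\<^sub>R x" using that K_mult by simp
      ultimately have "t \<le> spectral_radius N" by (rule real_eigenvalue_le_spectral_radius)
      then show False using False \<open>t \<ge> s\<close> s by simp
    qed
    then show ?thesis by (simp add: invertible_left_inverse matrix_left_invertible_ker)
  qed
  define T where "T = {t. t \<ge> s \<and> semipositive (K t)}"
  have T_nonempty: "T \<noteq> {}"
  proof -
    define t where "t = max s (1 + (\<Sum>i\<in>UNIV. \<Sum>j\<in>UNIV. N $ i $ j))"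
    have "(K t *v 1) $ i > 0" for i
    proof -
      have "(\<Sum>j\<in>UNIV. N $ i $ j) \<le> (\<Sum>i\<in>UNIV. \<Sum>j\<in>UNIV. N $ i $ j)"
        by (rule member_le_sum[of i UNIV "\<lambda>i. \<Sum>j\<in>UNIV. N $ i $ j"])
          (auto intro: sum_nonneg N_nonneg)
      then have "(\<Sum>j\<in>UNIV. N $ i $ j) < t" by (simp add: t_def)
      then show ?thesis unfolding K_mult by (simp add: matrix_vector_mult_def)
    qed
    then have "semipositive (K t)" unfolding semipositive_def by (intro exI[of _ 1]) simp
    moreover have "t \<ge> s" by (simp add: t_def)
    ultimately show ?thesis unfolding T_def by blast
  qed
  have T_bdd: "bdd_below T" unfolding T_def by (intro bdd_belowI[of _ s]) simp
  define \<tau> where "\<tau> = Inf T"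
  have \<tau>_ge: "\<tau> \<ge> s" unfolding \<tau>_def using T_nonempty by (intro cInf_greatest) (auto simp: T_def)
  obtain v where v: "K \<tau> *v v = 1"
    using K_inv[OF \<tau>_ge] by (metis invertible_right_inverse matrix_vector_mul_assoc matrix_vector_mul_lid)
  define \<epsilon> where "\<epsilon> = 1 / (1 + norm v)"
  have \<epsilon>: "\<epsilon> > 0" unfolding \<epsilon>_def by (simp add: add_pos_nonneg)
  have K_near: "(K t *v v) $ i > 0" if "\<bar>t - \<tau>\<bar> \<le> \<epsilon>" for t i
  proof -
    have "K t *v v = K \<tau> *v v + (t - \<tau>) *\<^sub>R v"
      by (simp add: K_mult algebra_simps)
    then have eq: "(K t *v v) $ i = 1 + (t - \<tau>) * v $ i" by (simp add: v)
    have "\<bar>(t - \<tau>) * v $ i\<bar> \<le> \<epsilon> * norm v"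
      unfolding abs_mult using that component_le_norm_cart[of v i] \<epsilon> by (intro mult_mono) auto
    also have "\<dots> < 1" unfolding \<epsilon>_def by (simp add: divide_simps add_pos_nonneg)
    finally show ?thesis using eq by linarith
  qed
  have "v \<ge> 0"
  proof -
    obtain t where t: "t \<in> T" "t < \<tau> + \<epsilon>"
      using cInf_lessD[OF T_nonempty, of "\<tau> + \<epsilon>"] \<epsilon> unfolding \<tau>_def by auto
    moreover have "t \<ge> \<tau>" unfolding \<tau>_def using t(1) T_bdd by (rule cInf_lower)
    ultimately have "K t *v v \<ge> 0"
      using K_near[of t] by (simp add: less_eq_vec_def less_imp_le)
    then show ?thesis
      using Z_matrix_semipositive_monotone[OF K_Z] t(1) unfolding T_def by blast
  qed
  then have v_pos: "v $ i > 0" for i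
    using Z_matrix_positive_preimage[OF K_Z[of \<tau>], of v i] v by simp
  then have near_T: "t \<in> T" if "t \<ge> s" "\<bar>t - \<tau>\<bar> \<le> \<epsilon>" for t
    using that K_near unfolding T_def semipositive_def by blast
  have "\<tau> = s"
  proof (rule ccontr)
    assume "\<tau> \<noteq> s"
    then have lt: "max s (\<tau> - \<epsilon>) < \<tau>" using \<tau>_ge \<epsilon> by simp
    then have "max s (\<tau> - \<epsilon>) \<in> T" by (intro near_T) auto
    then have "\<tau> \<le> max s (\<tau> - \<epsilon>)" unfolding \<tau>_def by (rule cInf_lower[OF _ T_bdd])
    then show False using lt by simp
  qed
  then have "s \<in> T" using near_T[of s] \<epsilon> by simp
  then show ?thesis unfolding T_def K_def M by simp
qed

section \<open>The T-Sylvester operator and its matrix\<close>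

definition sylvester_op :: "real ^ 'n ^ 'n \<Rightarrow> real ^ 'n ^ 'n \<Rightarrow> real ^ 'n ^ 'n \<Rightarrow> real ^ 'n ^ 'n" where
  "sylvester_op D A Z = D ** Z + transpose Z ** A"

text \<open>Stacking of columns: the first index is the column, so that block \<open>i\<close> of the vector is column
  \<open>i\<close> of the matrix, as required by \<open>vec (D X) = (I \<otimes> D) vec X\<close>.\<close>
definition vectorize :: "real ^ 'n ^ 'm \<Rightarrow> real ^ ('n::finite \<times> 'm::finite)" where
  "vectorize X = (\<chi> p. X $ snd p $ fst p)"

definition sylvester_matrix :: "real ^ 'n ^ 'n \<Rightarrow> real ^ 'n ^ 'n \<Rightarrow> real ^ ('n::finite \<times> 'n) ^ ('n \<times> 'n)" where
  "sylvester_matrix D A = kronecker (mat 1 :: real ^ 'n ^ 'n) D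
     + kronecker (transpose A) (mat 1 :: real ^ 'n ^ 'n) ** Pi_matrix"

lemma Pi_matrix_nth: "Pi_matrix $ p $ q = (if fst p = snd q \<and> snd p = fst q then 1 else 0)"
proof -
  have unit: "unit_matrix i j $ fst p $ fst q * unit_matrix j i $ snd p $ snd q
    = (if i = fst p then if j = fst q then if fst p = snd q \<and> snd p = fst q then 1 else 0 else 0 else 0)"
    for i j
    unfolding unit_matrix_def by auto
  have "Pi_matrix $ p $ q = (\<Sum>i\<in>UNIV. if i = fst p
      then \<Sum>j\<in>UNIV. if j = fst q then if fst p = snd q \<and> snd p = fst q then 1 else 0 else 0 else 0)"
    unfolding Pi_matrix_def kronecker_def
    unfolding vec_lambda_beta sum_component unit by (intro sum.cong refl) simp
  also have "\<dots> = (if fst p = snd q \<and> snd p = fst q then 1 else 0)"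
    unfolding sum.delta[OF finite] by simp
  finally show ?thesis .
qed

lemma kronecker_Pi_nth:
  fixes A :: "real ^ 'n ^ 'n"
  shows "(kronecker (transpose A) (mat 1 :: real ^ 'n ^ 'n) ** Pi_matrix) $ p $ q
    = (if snd p = fst q then A $ snd q $ fst p else 0)"
proof -
  have "(kronecker (transpose A) (mat 1 :: real ^ 'n ^ 'n) ** Pi_matrix) $ p $ q
    = (\<Sum>r\<in>UNIV. if r = (snd q, fst q) then (if snd p = fst q then A $ snd q $ fst p else 0) else 0)"
    unfolding matrix_matrix_mult_def vec_lambda_beta
  proof (rule sum.cong)
    fix r :: "'n \<times> 'n"
    show "kronecker (transpose A) (mat 1 :: real ^ 'n ^ 'n) $ p $ r * Pi_matrix $ r $ q
      = (if r = (snd q, fst q) then (if snd p = fst q then A $ snd q $ fst p else 0) else 0)"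
      by (cases r) (simp add: Pi_matrix_nth kronecker_def transpose_def mat_def)
  qed simp
  then show ?thesis by simp
qed

lemma sylvester_matrix_nth:
  "sylvester_matrix D A $ p $ q
    = (if fst p = fst q then D $ snd p $ snd q else 0) + (if snd p = fst q then A $ snd q $ fst p else 0)"
  unfolding sylvester_matrix_def
  by (simp add: kronecker_Pi_nth) (simp add: kronecker_def mat_def)

lemma sylvester_matrix_vectorize:
  "sylvester_matrix D A *v vectorize Z = vectorize (sylvester_op D A Z)"
proof -
  have "(sylvester_matrix D A *v vectorize Z) $ (i, k) = vectorize (sylvester_op D A Z) $ (i, k)" for i k
  proof -
    have "(sylvester_matrix D A *v vectorize Z) $ (i, k)
      = (\<Sum>j\<in>UNIV. \<Sum>l\<in>UNIV. ((if i = j then D $ k $ l else 0) + (if k = j then A $ l $ i else 0)) * Z $ l $ j)"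
      unfolding matrix_vector_mult_def sylvester_matrix_nth vectorize_def vec_lambda_beta
      by (simp only: sum.cartesian_product case_prod_unfold UNIV_Times_UNIV fst_conv snd_conv)
    also have "\<dots> = (\<Sum>j\<in>UNIV. (if i = j then \<Sum>l\<in>UNIV. D $ k $ l * Z $ l $ j else 0))
        + (\<Sum>j\<in>UNIV. (if k = j then \<Sum>l\<in>UNIV. A $ l $ i * Z $ l $ j else 0))"
      unfolding distrib_right sum.distrib by (intro arg_cong2[where f = "(+)"] sum.cong refl) auto
    also have "\<dots> = vectorize (sylvester_op D A Z) $ (i, k)"
      by (simp add: vectorize_def sylvester_op_def matrix_matrix_mult_def transpose_def mult.commute)
    finally show ?thesis .
  qed
  then show ?thesis by (simp add: vec_eq_iff split_paired_all)
qed

lemma vectorize_nonneg_iff: "vectorize X \<ge> 0 \<longleftrightarrow> X \<ge> 0"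
  by (simp add: vectorize_def less_eq_vec_def split_paired_All) blast

lemma vectorize_surj: "\<exists>X. vectorize X = x"
proof
  show "vectorize (\<chi> k i. x $ (i, k)) = x"
    unfolding vectorize_def vec_eq_iff by simp
qed

lemma vectorize_inject: "vectorize X = vectorize Y \<longleftrightarrow> X = Y"
proof
  assume eq: "vectorize X = vectorize Y"
  have "X $ k $ i = Y $ k $ i" for i k
    using arg_cong[OF eq, of "\<lambda>x. x $ (i, k)"] by (simp add: vectorize_def)
  then show "X = Y" by (simp add: vec_eq_iff)
qed simp

lemma sylvester_monotone:
  assumes "Z_matrix (sylvester_matrix D A)" "semipositive (sylvester_matrix D A)"
    and "sylvester_op D A Z \<ge> 0"
  shows "Z \<ge> 0"
proof -
  have "vectorize Z \<ge> 0"
    using Z_matrix_semipositive_monotone[OF assms(1,2)] assms(3)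
    unfolding sylvester_matrix_vectorize[symmetric] vectorize_nonneg_iff[symmetric] by blast
  then show ?thesis unfolding vectorize_nonneg_iff .
qed

lemma sylvester_unique_solution:
  assumes "Z_matrix (sylvester_matrix D A)" "semipositive (sylvester_matrix D A)"
  shows "\<exists>!Z. sylvester_op D A Z = E"
proof -
  have inv: "invertible (sylvester_matrix D A)"
    using assms by (rule Z_matrix_semipositive_invertible)
  then obtain x where "sylvester_matrix D A *v x = vectorize E"
    by (metis invertible_right_inverse matrix_vector_mul_assoc matrix_vector_mul_lid)
  then obtain Z where Z: "sylvester_op D A Z = E"
    using vectorize_surj[of x] by (auto simp: sylvester_matrix_vectorize vectorize_inject)
  show ?thesis
  proof (rule ex1I[of _ Z])
    fix Z' assume "sylvester_op D A Z' = E"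
    then have "sylvester_matrix D A *v vectorize Z' = sylvester_matrix D A *v vectorize Z"
      using Z by (simp add: sylvester_matrix_vectorize)
    then have "vectorize Z' = vectorize Z"
      using inv by (metis invertible_left_inverse matrix_left_invertible_injective injD)
    then show "Z' = Z" by (simp add: vectorize_inject)
  qed (fact Z)
qed

text \<open>A nonnegative witness suffices, because the Z-matrix sign pattern makes it positive.\<close>
lemma sylvester_semipositiveI:
  assumes "Z_matrix (sylvester_matrix D A)" "V \<ge> 0"
    and "pos_matrix (sylvester_op D A V)"
  shows "semipositive (sylvester_matrix D A)"
proof -
  have pos: "(sylvester_matrix D A *v vectorize V) $ p > 0" for p
    using assms(3) unfolding sylvester_matrix_vectorize by (simp add: vectorize_def pos_matrix_def)
  moreover have "vectorize V \<ge> 0" using assms(2) by (simp add: vectorize_nonneg_iff)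
  ultimately show ?thesis
    using Z_matrix_positive_preimage[OF assms(1)] unfolding semipositive_def by blast
qed

section \<open>The Newton step\<close>

abbreviation newton_op ::
  "real ^ 'n ^ 'n \<Rightarrow> real ^ 'n ^ 'n \<Rightarrow> real ^ 'n ^ 'n \<Rightarrow> real ^ 'n ^ 'n \<Rightarrow> real ^ 'n ^ 'n \<Rightarrow> real ^ 'n ^ 'n" where
  "newton_op A B D X \<equiv> sylvester_op (D - transpose X ** B) (A - B ** X)"

abbreviation newton_matrix ::
  "real ^ 'n ^ 'n \<Rightarrow> real ^ 'n ^ 'n \<Rightarrow> real ^ 'n ^ 'n \<Rightarrow> real ^ 'n ^ 'n \<Rightarrow> real ^ ('n::finite \<times> 'n) ^ ('n \<times> 'n)" where
  "newton_matrix A B D X \<equiv> sylvester_matrix (D - transpose X ** B) (A - B ** X)"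

lemma matrix_diff_ldistrib: "P ** (Q - R) = P ** Q - P ** R" for P :: "real ^ 'n ^ 'm"
  by (simp add: matrix_matrix_mult_def vec_eq_iff right_diff_distrib sum_subtractf)

lemma matrix_diff_rdistrib: "(P - Q) ** R = P ** R - Q ** R" for P :: "real ^ 'n ^ 'm"
  by (simp add: matrix_matrix_mult_def vec_eq_iff left_diff_distrib sum_subtractf)

lemma matrix_mult_zero: "P ** 0 = 0" "0 ** P = 0" for P :: "real ^ 'n ^ 'm"
  by (simp_all add: matrix_matrix_mult_def vec_eq_iff)

lemma transpose_diff: "transpose (X - Y) = transpose X - transpose Y" for X Y :: "real ^ 'n ^ 'm"
  by (simp add: transpose_def vec_eq_iff)

lemma transpose_zero: "transpose 0 = (0 :: real ^ 'n ^ 'm)"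
  by (simp add: transpose_def vec_eq_iff)

lemma sylvester_op_diff: "sylvester_op D A (X - Y) = sylvester_op D A X - sylvester_op D A Y"
  by (simp add: sylvester_op_def matrix_diff_ldistrib matrix_diff_rdistrib transpose_diff)

lemma matrix_mult_nonneg:
  fixes P :: "real ^ 'n ^ 'm" and Q :: "real ^ 'k ^ 'n"
  assumes "P \<ge> 0" "Q \<ge> 0"
  shows "P ** Q \<ge> 0"
  using assms by (auto simp: less_eq_vec_def matrix_matrix_mult_def intro!: sum_nonneg mult_nonneg_nonneg)

lemma transpose_nonneg: "X \<ge> 0 \<Longrightarrow> transpose X \<ge> 0" for X :: "real ^ 'n ^ 'm"
  by (simp add: less_eq_vec_def transpose_def)

lemma congruence_nonneg:
  fixes B :: "real ^ 'n ^ 'n"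
  assumes "B \<ge> 0" "U \<ge> 0"
  shows "transpose U ** B ** U \<ge> 0"
  using assms by (intro matrix_mult_nonneg transpose_nonneg)

text \<open>Passing from \<open>0\<close> to \<open>X \<ge> 0\<close> only decreases entries of the matrix.\<close>
lemma Z_matrix_newton:
  assumes "Z_matrix (sylvester_matrix D A)" "B \<ge> 0" "X \<ge> 0"
  shows "Z_matrix (newton_matrix A B D X)"
proof -
  have "transpose X ** B \<ge> 0" "B ** X \<ge> 0"
    using assms(2,3) by (auto intro: matrix_mult_nonneg transpose_nonneg)
  then have "(transpose X ** B) $ i $ j \<ge> 0" "(B ** X) $ i $ j \<ge> 0" for i j
    by (simp_all add: less_eq_vec_def)
  then have "newton_matrix A B D X $ p $ q \<le> sylvester_matrix D A $ p $ q" for p q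
    unfolding sylvester_matrix_nth by (intro add_mono) simp_all
  then show ?thesis using assms(1) unfolding Z_matrix_def by (meson order_trans)
qed

text \<open>The exact second order expansion of the Riccati map around \<open>X\<close>; the following lemmas are
  rearrangements of it.\<close>
lemma riccati_linearization:
  "newton_op A B D X Z
    = riccati A B C D Z + transpose (Z - X) ** B ** (Z - X) - transpose X ** B ** X - C"
  unfolding riccati_def sylvester_op_def transpose_diff
  by (simp add: matrix_diff_ldistrib matrix_diff_rdistrib matrix_mul_assoc)

lemma newton_op_diff:
  "newton_op A B D X (W - Z)
    = riccati A B C D W + transpose (W - X) ** B ** (W - X)
      - (riccati A B C D Z + transpose (Z - X) ** B ** (Z - X))"
  unfolding sylvester_op_diff riccati_linearization[where C = C] by simp

lemma newton_eq_iff_newton_op: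
  "newton_eq A B C D X Z \<longleftrightarrow> newton_op A B D X Z = - (transpose X ** B ** X) - C"
  unfolding newton_eq_def sylvester_op_def ..

text \<open>The residual of a Newton iterate is the second order term alone: for \<open>B \<ge> 0\<close> it is nonpositive when the
  step is monotone, and tending to zero when the iteration converges.\<close>
lemma newton_eq_iff:
  "newton_eq A B C D X Z \<longleftrightarrow> riccati A B C D Z = - (transpose (Z - X) ** B ** (Z - X))"
  unfolding newton_eq_iff_newton_op riccati_linearization[where C = C]
  by (simp add: eq_neg_iff_add_eq_0)

lemma newton_op_diff_step:
  assumes "newton_eq A B C D X Z"
  shows "newton_op A B D X (W - Z) = riccati A B C D W + transpose (W - X) ** B ** (W - X)"
  using assms unfolding newton_eq_iff newton_op_diff[where C = C] by simp

text \<open>One lemma for both upper bounds: \<open>W\<close> is used as the minimal solution and as the point with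
  positive residual.\<close>
lemma newton_step_le:
  assumes "Z_matrix (newton_matrix A B D X)"
    and "semipositive (newton_matrix A B D X)"
    and "newton_eq A B C D X Z" "B \<ge> 0" "X \<le> W" "riccati A B C D W \<ge> 0"
  shows "Z \<le> W"
proof -
  have "transpose (W - X) ** B ** (W - X) \<ge> 0"
    using assms(4,5) by (intro congruence_nonneg) (simp_all add: less_eq_vec_def)
  then have "newton_op A B D X (W - Z) \<ge> 0"
    using assms(6) unfolding newton_op_diff_step[OF assms(3)] by (simp add: less_eq_vec_def)
  then have "W - Z \<ge> 0" by (rule sylvester_monotone[OF assms(1,2)])
  then show ?thesis by (simp add: less_eq_vec_def)
qed

lemma newton_step_ge:
  assumes "Z_matrix (newton_matrix A B D X)"
    and "semipositive (newton_matrix A B D X)"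
    and "newton_eq A B C D X Z" "riccati A B C D X \<le> 0"
  shows "X \<le> Z"
proof -
  have "newton_op A B D X (Z - X) = - riccati A B C D X"
    using assms(3) unfolding newton_eq_iff newton_op_diff[where C = C]
    by (simp add: matrix_mult_zero)
  then have "newton_op A B D X (Z - X) \<ge> 0"
    using assms(4) by (simp add: less_eq_vec_def)
  then have "Z - X \<ge> 0" by (rule sylvester_monotone[OF assms(1,2)])
  then show ?thesis by (simp add: less_eq_vec_def)
qed

text \<open>The difference \<open>Y - X\<close> is mapped to a matrix that dominates the positive residual at \<open>Y\<close>.\<close>
lemma semipositive_newton:
  assumes "Z_matrix (newton_matrix A B D X)"
    and "B \<ge> 0" "riccati A B C D X \<le> 0" "X \<le> Y" "pos_matrix (riccati A B C D Y)"
  shows "semipositive (newton_matrix A B D X)"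
proof (rule sylvester_semipositiveI[OF assms(1)])
  show YX: "Y - X \<ge> 0" using assms(4) by (simp add: less_eq_vec_def)
  have eq: "newton_op A B D X (Y - X)
    = riccati A B C D Y + transpose (Y - X) ** B ** (Y - X) - riccati A B C D X"
    unfolding newton_op_diff[where C = C] by (simp add: matrix_mult_zero)
  have "transpose (Y - X) ** B ** (Y - X) \<ge> 0" using assms(2) YX by (rule congruence_nonneg)
  then show "pos_matrix (newton_op A B D X (Y - X))"
    using assms(3,5) unfolding eq pos_matrix_def less_eq_vec_def
    by simp (smt (verit))
qed

section \<open>Convergence of the Newton iteration\<close>

lemma tendsto_matrix_mult:
  fixes P :: "'a \<Rightarrow> real ^ 'n ^ 'm" and Q :: "'a \<Rightarrow> real ^ 'k ^ 'n"
  assumes "(P \<longlongrightarrow> P') F" "(Q \<longlongrightarrow> Q') F"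
  shows "((\<lambda>x. P x ** Q x) \<longlongrightarrow> P' ** Q') F"
  unfolding matrix_matrix_mult_def by (intro tendsto_intros assms)

lemma tendsto_transpose:
  fixes P :: "'a \<Rightarrow> real ^ 'n ^ 'm"
  assumes "(P \<longlongrightarrow> P') F"
  shows "((\<lambda>x. transpose (P x)) \<longlongrightarrow> transpose P') F"
  unfolding transpose_def by (intro tendsto_intros assms)

lemma increasing_bounded_matrix_convergent:
  fixes X :: "nat \<Rightarrow> real ^ 'n ^ 'm"
  assumes "\<And>k. X k \<le> X (Suc k)" "\<And>k. X k \<le> W"
  obtains L where "X \<longlonglongrightarrow> L" "\<And>k. X k \<le> L" "L \<le> W"
proof -
  have "\<exists>l. (\<lambda>k. X k $ i $ j) \<longlonglongrightarrow> l \<and> (\<forall>k. X k $ i $ j \<le> l)" for i j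
  proof -
    have "incseq (\<lambda>k. X k $ i $ j)"
      using assms(1) by (intro incseq_SucI) (simp add: less_eq_vec_def)
    moreover have "\<forall>k. X k $ i $ j \<le> W $ i $ j"
      using assms(2) by (simp add: less_eq_vec_def)
    ultimately show ?thesis by (metis incseq_convergent)
  qed
  then obtain l where l: "\<And>i j. (\<lambda>k. X k $ i $ j) \<longlonglongrightarrow> l i j" "\<And>i j k. X k $ i $ j \<le> l i j"
    by metis
  show thesis
  proof
    show "X \<longlonglongrightarrow> (\<chi> i j. l i j)" by (intro vec_tendstoI) (simp add: l(1))
    show "X k \<le> (\<chi> i j. l i j)" for k by (simp add: less_eq_vec_def l(2))
    have "l i j \<le> W $ i $ j" for i j
      using l(1) by (rule LIMSEQ_le_const2) (use assms(2) in \<open>simp add: less_eq_vec_def\<close>)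
    then show "(\<chi> i j. l i j) \<le> W" by (simp add: less_eq_vec_def)
  qed
qed

lemma newton_limit_solution:
  assumes "\<And>k. newton_eq A B C D (X k) (X (Suc k))" "X \<longlonglongrightarrow> L"
  shows "riccati A B C D L = 0"
proof -
  have lim: "(\<lambda>k. X (Suc k)) \<longlonglongrightarrow> L" using assms(2) by (rule LIMSEQ_Suc)
  have "(\<lambda>k. riccati A B C D (X (Suc k))) \<longlonglongrightarrow> riccati A B C D L"
    unfolding riccati_def by (intro tendsto_intros tendsto_matrix_mult tendsto_transpose lim)
  moreover have "(\<lambda>k. riccati A B C D (X (Suc k))) \<longlonglongrightarrow> - (transpose (L - L) ** B ** (L - L))"
    unfolding assms(1)[unfolded newton_eq_iff]
    by (intro tendsto_intros tendsto_matrix_mult tendsto_transpose lim assms(2))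
  ultimately have "riccati A B C D L = - (transpose (L - L) ** B ** (L - L))"
    by (rule LIMSEQ_unique)
  then show ?thesis by (simp add: matrix_mult_zero)
qed

theorem theorem3p3:
  fixes A B C D Xmin :: "real ^ 'n ^ 'n"
  assumes "B \<ge> 0" and "C \<le> 0"
    and "M_matrix (kronecker (mat 1 :: real ^ 'n ^ 'n) D
           + kronecker (transpose A) (mat 1 :: real ^ 'n ^ 'n) ** Pi_matrix)"
    and "invertible (kronecker (mat 1 :: real ^ 'n ^ 'n) D
           + kronecker (transpose A) (mat 1 :: real ^ 'n ^ 'n) ** Pi_matrix)"
    and "minimal_nonneg_solution A B C D Xmin"
    and "\<exists>Y. Y \<ge> 0 \<and> pos_matrix (riccati A B C D Y)"
  shows "\<exists>X :: nat \<Rightarrow> real ^ 'n ^ 'n.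
    X 0 = 0 \<and>
    (\<forall>k. newton_eq A B C D (X k) (X (Suc k)) \<and> (\<exists>!Z. newton_eq A B C D (X k) Z)) \<and>
    (\<forall>k. X k \<le> X (Suc k) \<and> X (Suc k) \<le> Xmin) \<and>
    X \<longlonglongrightarrow> Xmin"
proof -
  obtain Y where Y: "Y \<ge> 0" "pos_matrix (riccati A B C D Y)" using assms(6) by blast
  have Xmin: "riccati A B C D Xmin = 0" "Xmin \<ge> 0"
    "\<And>X. riccati A B C D X = 0 \<Longrightarrow> X \<ge> 0 \<Longrightarrow> Xmin \<le> X"
    using assms(5) unfolding minimal_nonneg_solution_def by blast+
  have Z0: "Z_matrix (sylvester_matrix D A)" and S0: "semipositive (sylvester_matrix D A)"
    using assms(3,4) invertible_M_matrix_semipositive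
    unfolding sylvester_matrix_def M_matrix_def by blast+
  \<comment> \<open>The invariant of the iteration. The bound by \<open>Y\<close> and the sign of the residual are what
    carries semipositivity of the Newton matrix to the next iterate.\<close>
  define good where "good X \<longleftrightarrow> X \<ge> 0 \<and> riccati A B C D X \<le> 0 \<and> X \<le> Xmin \<and> X \<le> Y
    \<and> semipositive (newton_matrix A B D X)" for X
  have ZX: "Z_matrix (newton_matrix A B D X)" if "good X" for X
    using Z_matrix_newton[OF Z0 assms(1)] that unfolding good_def by blast
  have unique: "\<exists>!Z. newton_eq A B C D X Z" if "good X" for X
    unfolding newton_eq_iff_newton_op
    using sylvester_unique_solution[OF ZX[OF that]] that unfolding good_def by blast
  have step: "good Z \<and> X \<le> Z" if "good X" "newton_eq A B C D X Z" for X Z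
  proof -
    have gX: "X \<ge> 0" "riccati A B C D X \<le> 0" "X \<le> Xmin" "X \<le> Y"
      "semipositive (newton_matrix A B D X)"
      using that(1) unfolding good_def by blast+
    note op = ZX[OF that(1)] gX(5) that(2)
    have XZ: "X \<le> Z" using newton_step_ge[OF op gX(2)] .
    have "Z \<ge> 0" using gX(1) XZ by (rule order_trans)
    moreover have RZ: "riccati A B C D Z \<le> 0"
    proof -
      have "transpose (Z - X) ** B ** (Z - X) \<ge> 0"
        using assms(1) XZ by (intro congruence_nonneg) (simp_all add: less_eq_vec_def)
      then show ?thesis using that(2) unfolding newton_eq_iff by (simp add: less_eq_vec_def)
    qed
    moreover have "Z \<le> Xmin"
      using newton_step_le[OF op assms(1) gX(3)] Xmin(1) by simp
    moreover have ZY: "Z \<le> Y"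
    proof -
      have "riccati A B C D Y \<ge> 0"
        using Y(2) by (simp add: pos_matrix_def less_eq_vec_def less_imp_le)
      then show ?thesis by (rule newton_step_le[OF op assms(1) gX(4)])
    qed
    moreover have "semipositive (newton_matrix A B D Z)"
      using semipositive_newton[OF Z_matrix_newton[OF Z0 assms(1) \<open>Z \<ge> 0\<close>] assms(1) RZ ZY Y(2)] .
    ultimately show ?thesis using XZ unfolding good_def by blast
  qed
  have good0: "good 0"
    using assms(2) Y(1) Xmin(2) S0 unfolding good_def riccati_def
    by (simp add: matrix_mult_zero transpose_zero)
  define X where "X = rec_nat 0 (\<lambda>_ X. THE Z. newton_eq A B C D X Z)"
  have X0: "X 0 = 0" by (simp add: X_def)
  have newton: "newton_eq A B C D (X k) (X (Suc k))" if "good (X k)" for k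
    using theI'[OF unique[OF that]] by (simp add: X_def)
  have good: "good (X k)" for k
    by (induction k) (use good0 X0 step newton in auto)
  have inc: "X k \<le> X (Suc k)" for k using step good newton by blast
  have le: "X k \<le> Xmin" for k using good unfolding good_def by blast
  obtain L where L: "X \<longlonglongrightarrow> L" "\<And>k. X k \<le> L" "L \<le> Xmin"
    using increasing_bounded_matrix_convergent[of X Xmin] inc le by blast
  have "riccati A B C D L = 0" using newton_limit_solution newton good L(1) by blast
  moreover have "L \<ge> 0" using L(2)[of 0] X0 by simp
  ultimately have "L = Xmin" using Xmin(3) L(3) by (blast intro: order_antisym)
  then show ?thesis
    using X0 newton good unique inc le L(1) by blast
qed

end
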